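(* (1) $S_{3,1,1}\not\le C_4$. (2) For every integer $k\ge 5$, $S_{3,1,1}\le C_k$.
   Context: All graphs are finite and simple, considered up to isomorphism. An edge-colored graph is a pair $(G,c)$ with $c\colon E(G)\to\mathbb{N}$ an arbitrary map (not necessarily proper); it is colored in $t$ or more colors if $|c(E(G))|\ge t$. A subgraph (not necessarily induced) is rainbow if its edges receive pairwise distinct colors. $(G,c)$ is rainbow $H$-free if $G$ contains no rainbow subgraph isomorphic to $H$. For graphs $H_1,H_2$, write $H_1\le H_2$ if there is a positive integer $t$ such that every rainbow $H_1$-free edge-colored complete graph colored in $t$ or more colors is rainbow $H_2$-free. $C_k$ is the cycle on $k$ vertices. For positive integers $a,b,c$, $S_{a,b,c}$ is the tree consisting of one vertex (the branch vertex) joined by three internally disjoint paths of lengths $a$, $b$, $c$; it has $a+b+c+1$ vertices. *)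

theory Defs
  imports Main
begin

type_synonym 'a graph = "'a set \<times> 'a set set"

abbreviation verts :: "'a graph \<Rightarrow> 'a set" where
  "verts G \<equiv> fst G"

abbreviation edges :: "'a graph \<Rightarrow> 'a set set" where
  "edges G \<equiv> snd G"

definition all_pairs :: "'a set \<Rightarrow> 'a set set" where
  "all_pairs V = {e. e \<subseteq> V \<and> card e = 2}"

definition simple_graph :: "'a graph \<Rightarrow> bool" where
  "simple_graph G \<longleftrightarrow> finite (verts G) \<and> edges G \<subseteq> all_pairs (verts G)"

definition complete_graph :: "'a graph \<Rightarrow> bool" where
  "complete_graph G \<longleftrightarrow> simple_graph G \<and> edges G = all_pairs (verts G)"

definition subgraph :: "'a graph \<Rightarrow> 'a graph \<Rightarrow> bool" where
  "subgraph S G \<longleftrightarrow> simple_graph S \<and> verts S \<subseteq> verts G \<and> edges S \<subseteq> edges G"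

definition graph_iso :: "'a graph \<Rightarrow> 'b graph \<Rightarrow> bool" where
  "graph_iso G H \<longleftrightarrow>
     (\<exists>f. bij_betw f (verts G) (verts H) \<and>
          (\<forall>u\<in>verts G. \<forall>v\<in>verts G. {u, v} \<in> edges G \<longleftrightarrow> {f u, f v} \<in> edges H))"

text \<open>A coloring is a total function on sets of vertices; only its values on the edges
  of the graph it is used with are relevant.\<close>

type_synonym 'a coloring = "'a set \<Rightarrow> nat"

definition rainbow :: "'a graph \<Rightarrow> 'a coloring \<Rightarrow> bool" where
  "rainbow S c \<longleftrightarrow> inj_on c (edges S)"

definition rainbow_free :: "'b graph \<Rightarrow> 'a graph \<Rightarrow> 'a coloring \<Rightarrow> bool" where
  "rainbow_free H G c \<longleftrightarrow> \<not> (\<exists>S. subgraph S G \<and> graph_iso S H \<and> rainbow S c)"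

text \<open>The host graphs have natural numbers as vertices. This is no restriction: every finite
  graph is isomorphic to one of these.\<close>

definition rainbow_le :: "'a graph \<Rightarrow> 'b graph \<Rightarrow> bool" where
  "rainbow_le H1 H2 \<longleftrightarrow>
     (\<exists>t\<ge>1. \<forall>(K :: nat graph) c.
        complete_graph K \<longrightarrow> card (c ` edges K) \<ge> t \<longrightarrow>
        rainbow_free H1 K c \<longrightarrow> rainbow_free H2 K c)"

text \<open>The cycle on \<open>k\<close> vertices; it is meaningful only for \<open>k \<ge> 3\<close>.\<close>

definition cycle_graph :: "nat \<Rightarrow> nat graph" where
  "cycle_graph k = ({..<k}, {{i, (i + 1) mod k} | i. i < k})"

text \<open>\<open>leg_vertex l i\<close> is the vertex at distance \<open>i\<close> from the branch vertex on leg \<open>l\<close>;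
  all three legs (\<open>l = 0, 1, 2\<close>) start in the branch vertex \<open>(0, 0)\<close>.\<close>

definition leg_vertex :: "nat \<Rightarrow> nat \<Rightarrow> nat \<times> nat" where
  "leg_vertex l i = (if i = 0 then (0, 0) else (l, i))"

definition spider_graph :: "nat \<Rightarrow> nat \<Rightarrow> nat \<Rightarrow> (nat \<times> nat) graph" where
  "spider_graph a b c =
     ({leg_vertex l i | l i. l < 3 \<and> i \<le> [a, b, c] ! l},
      {{leg_vertex l i, leg_vertex l (i + 1)} | l i. l < 3 \<and> i < [a, b, c] ! l})"

lemma simple_graph_cycle_graph:
  assumes "k \<ge> 3"
  shows "simple_graph (cycle_graph k)"
proof -
  have "i \<noteq> (i + 1) mod k" if "i < k" for i
    using that assms by (cases "i + 1 = k") auto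
  then show ?thesis
    using assms by (auto simp: simple_graph_def cycle_graph_def all_pairs_def card_2_iff)
qed

lemma verts_spider_graph:
  "verts (spider_graph a b c) =
     insert (0, 0) ({0} \<times> {1..a} \<union> {1} \<times> {1..b} \<union> {2} \<times> {1..c})"
proof -
  have l3: "{..<3} = {0, 1, 2 :: nat}"
    by auto
  have leg: "leg_vertex l ` {..n} = insert (0, 0) ({l} \<times> {1..n})" for l n
    by (auto simp: leg_vertex_def image_iff Suc_le_eq intro: bexI[of _ 0])
  have "verts (spider_graph a b c) =
      (\<Union>l\<in>{..<3}. leg_vertex l ` {..[a, b, c] ! l})"
    by (auto simp: spider_graph_def)
  also have "\<dots> = leg_vertex 0 ` {..a} \<union> leg_vertex 1 ` {..b} \<union> leg_vertex 2 ` {..c}"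
    unfolding l3 by auto
  also have "\<dots> = insert (0, 0) ({0} \<times> {1..a} \<union> {1} \<times> {1..b} \<union> {2} \<times> {1..c})"
    unfolding leg by blast
  finally show ?thesis .
qed

lemma card_verts_spider_graph: "card (verts (spider_graph a b c)) = a + b + c + 1"
proof -
  have "card ({0::nat} \<times> {1..a} \<union> {1} \<times> {1..b} \<union> {2} \<times> {1..c}) = a + b + c"
    by (subst card_Un_disjoint; (subst card_Un_disjoint)?; auto simp: card_cartesian_product)
  then show ?thesis
    by (simp add: verts_spider_graph card_insert_if)
qed

lemma simple_graph_spider_graph: "simple_graph (spider_graph a b c)"
proof -
  have "finite (verts (spider_graph a b c))"
    by (simp add: verts_spider_graph)
  moreover have "edges (spider_graph a b c) \<subseteq> all_pairs (verts (spider_graph a b c))"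
  proof
    fix e assume "e \<in> edges (spider_graph a b c)"
    then obtain l i where li: "l < 3" "i < [a, b, c] ! l"
      and e: "e = {leg_vertex l i, leg_vertex l (i + 1)}"
      by (auto simp: spider_graph_def)
    have "leg_vertex l i \<noteq> leg_vertex l (i + 1)"
      by (simp add: leg_vertex_def)
    moreover have "leg_vertex l j \<in> verts (spider_graph a b c)" if "j \<le> i + 1" for j
    proof -
      have "j \<le> [a, b, c] ! l"
        using li that by linarith
      then show ?thesis
        using li unfolding spider_graph_def fst_conv by blast
    qed
    ultimately show "e \<in> all_pairs (verts (spider_graph a b c))"
      by (simp add: e all_pairs_def)
  qed
  ultimately show ?thesis
    by (simp add: simple_graph_def)
qed

end

theory Submission
  imports Defs
begin

text \<open>For the 4-cycle, give pairwise distinct colors to the edges of the disjoint union of a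
  4-cycle and a large matching, and one further color to all other edges. A rainbow
  \<open>S\<^sub>3\<^sub>,\<^sub>1\<^sub>,\<^sub>1\<close> would have at most one edge of the further color, and since the union
  has maximum degree 2, at least five of its vertices would have to lie on the 4-cycle.

  For \<open>k \<ge> 5\<close>, let \<open>w\<close> be a rainbow \<open>k\<close>-cycle. Spiders centered on the cycle
  with its two neighbouring cycle edges show that each edge between the cycle and a vertex
  outside has the color of a cycle edge. At most \<open>2 ^ k\<close> colors occur
  inside the cycle, so if there are more colors then a color not on the cycle occurs on an edge
  \<open>{x, y}\<close> disjoint from it, and a rainbow spider is found with this edge as a leg at \<open>x\<close>,
  or, in an exceptional case for \<open>k = 5\<close>, as the start of its long leg.\<close>

section \<open>Rainbow copies as injective vertex maps\<close>

lemma mem_all_pairs_iff: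
  "e \<in> all_pairs V \<longleftrightarrow> (\<exists>u v. e = {u, v} \<and> u \<noteq> v \<and> u \<in> V \<and> v \<in> V)"
  by (auto simp: all_pairs_def card_2_iff)

lemma image_all_pairs:
  assumes "inj_on f V" "e \<in> all_pairs V"
  shows "f ` e \<in> all_pairs (f ` V)"
  using assms by (auto simp: mem_all_pairs_iff inj_on_def)

text \<open>In a complete host every injective vertex map sends edges of \<open>H\<close> to edges,
  so the later arguments can use injections instead of subgraphs and isomorphisms.\<close>

lemma rainbow_free_complete_iff:
  assumes K: "complete_graph K" and H: "simple_graph H"
  shows "rainbow_free H K c \<longleftrightarrow>
    \<not> (\<exists>g. inj_on g (verts H) \<and> g ` verts H \<subseteq> verts K \<and> inj_on (\<lambda>e. c (g ` e)) (edges H))"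
proof -
  have EH: "edges H \<subseteq> all_pairs (verts H)" and fH: "finite (verts H)"
    using H by (auto simp: simple_graph_def)
  have "(\<exists>S. subgraph S K \<and> graph_iso S H \<and> rainbow S c) \<longleftrightarrow>
    (\<exists>g. inj_on g (verts H) \<and> g ` verts H \<subseteq> verts K \<and> inj_on (\<lambda>e. c (g ` e)) (edges H))"
    (is "?L \<longleftrightarrow> ?R")
  proof
    assume ?L
    then obtain S f where S: "subgraph S K" and r: "rainbow S c"
      and f: "bij_betw f (verts S) (verts H)"
      and fe: "\<forall>u\<in>verts S. \<forall>v\<in>verts S. {u, v} \<in> edges S \<longleftrightarrow> {f u, f v} \<in> edges H"
      by (auto simp: graph_iso_def)
    define g where "g = inv_into (verts S) f"
    have g: "bij_betw g (verts H) (verts S)"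
      unfolding g_def by (rule bij_betw_inv_into[OF f])
    have fg: "f (g v) = v" if "v \<in> verts H" for v
      unfolding g_def by (rule bij_betw_inv_into_right[OF f that])
    have gV: "g v \<in> verts S" if "v \<in> verts H" for v
      using g that by (auto simp: bij_betw_def)
    have gE: "g ` e \<in> edges S" if e: "e \<in> edges H" for e
    proof -
      obtain u v where "e = {u, v}" "u \<in> verts H" "v \<in> verts H"
        using e EH by (auto simp: mem_all_pairs_iff subset_iff)
      then show ?thesis using e fe fg gV by simp
    qed
    have "inj_on (\<lambda>e. g ` e) (edges H)"
    proof (rule inj_onI)
      fix d e assume "d \<in> edges H" "e \<in> edges H" "g ` d = g ` e"
      moreover have "d \<subseteq> verts H" "e \<subseteq> verts H"
        using calculation EH by (auto simp: all_pairs_def)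
      ultimately show "d = e"
        using g by (metis bij_betw_def inj_on_image_eq_iff)
    qed
    moreover have "inj_on c ((\<lambda>e. g ` e) ` edges H)"
      using r gE by (auto simp: rainbow_def intro: inj_on_subset)
    ultimately have "inj_on (\<lambda>e. c (g ` e)) (edges H)"
      using comp_inj_on[of "\<lambda>e. g ` e" "edges H" c] by (simp add: comp_def)
    then show ?R
      using g S by (auto simp: bij_betw_def subgraph_def)
  next
    assume ?R
    then obtain g where g: "inj_on g (verts H)" "g ` verts H \<subseteq> verts K"
      and r: "inj_on (\<lambda>e. c (g ` e)) (edges H)"
      by blast
    define S where "S = (g ` verts H, (\<lambda>e. g ` e) ` edges H)"
    define f where "f = inv_into (verts H) g"
    have "edges S \<subseteq> all_pairs (verts S)"
      unfolding S_def using EH image_all_pairs[OF g(1)] by auto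
    moreover have "all_pairs (verts S) \<subseteq> all_pairs (verts K)"
      using g by (auto simp: S_def all_pairs_def)
    ultimately have "subgraph S K"
      using K g fH by (auto simp: subgraph_def complete_graph_def simple_graph_def S_def)
    moreover have "rainbow S c"
      using r by (auto simp: rainbow_def S_def inj_on_def)
    moreover have "graph_iso S H"
      unfolding graph_iso_def
    proof (intro exI conjI ballI)
      show "bij_betw f (verts S) (verts H)"
        unfolding f_def S_def fst_conv
        by (rule bij_betw_inv_into) (use g in \<open>simp add: bij_betw_def\<close>)
      fix u v assume "u \<in> verts S" "v \<in> verts S"
      then obtain u' v' where uv: "u' \<in> verts H" "v' \<in> verts H" "u = g u'" "v = g v'"
        by (auto simp: S_def)
      have "f u = u'" "f v = v'"
        unfolding f_def using uv g(1) by auto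
      moreover have "{u, v} \<in> edges S \<longleftrightarrow> {u', v'} \<in> edges H"
      proof
        assume "{u, v} \<in> edges S"
        then obtain e where e: "e \<in> edges H" "{u, v} = g ` e"
          by (auto simp: S_def)
        have "g ` {u', v'} = g ` e" using e uv by simp
        moreover have "e \<subseteq> verts H" "{u', v'} \<subseteq> verts H"
          using e EH uv by (auto simp: all_pairs_def)
        ultimately have "{u', v'} = e"
          using g(1) by (metis inj_on_image_eq_iff)
        then show "{u', v'} \<in> edges H" using e by simp
      next
        assume "{u', v'} \<in> edges H"
        then have "g ` {u', v'} \<in> edges S"
          unfolding S_def snd_conv by (rule imageI)
        then show "{u, v} \<in> edges S" using uv by simp
      qed
      ultimately show "{u, v} \<in> edges S \<longleftrightarrow> {f u, f v} \<in> edges H" by simp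
    qed
    ultimately show ?L by blast
  qed
  then show ?thesis by (simp add: rainbow_free_def)
qed

lemma verts_spider_311:
  "verts (spider_graph 3 1 1) = {(0,0), (0,1), (0,2), (0,3), (1,1), (2,1)}"
  unfolding verts_spider_graph by (auto simp: atLeastAtMost_iff)

lemma edges_spider_311:
  "edges (spider_graph 3 1 1) =
    {{(0,0),(0,1)}, {(0,1),(0,2)}, {(0,2),(0,3)}, {(0,0),(1,1)}, {(0,0),(2,1)}}"
proof -
  have l3: "{..<3} = {0, 1, 2 :: nat}"
    by auto
  have "edges (spider_graph a b c) =
      (\<Union>l\<in>{..<3}. (\<lambda>i. {leg_vertex l i, leg_vertex l (i + 1)}) ` {..<[a, b, c] ! l})" for a b c
    by (auto simp: spider_graph_def)
  then show ?thesis
    unfolding l3 by (auto simp: leg_vertex_def lessThan_Suc numeral_3_eq_3 numeral_2_eq_2)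
qed

text \<open>Here \<open>b\<close> is the branch vertex, \<open>p\<close>, \<open>q\<close>,
  \<open>r\<close> the long leg and \<open>s\<close>, \<open>u\<close> the short legs.\<close>

lemma rainbow_free_spider_311_iff:
  assumes K: "complete_graph K"
  shows "rainbow_free (spider_graph 3 1 1) K c \<longleftrightarrow>
    (\<forall>b p q r s u. distinct [b, p, q, r, s, u] \<longrightarrow> {b, p, q, r, s, u} \<subseteq> verts K \<longrightarrow>
      \<not> distinct [c {b, p}, c {p, q}, c {q, r}, c {b, s}, c {b, u}])"
    (is "?L \<longleftrightarrow> ?R")
proof
  assume L: ?L
  show ?R
  proof (intro allI impI notI)
    fix b p q r s u
    assume d: "distinct [b, p, q, r, s, u]" and V: "{b, p, q, r, s, u} \<subseteq> verts K"
      and col: "distinct [c {b, p}, c {p, q}, c {q, r}, c {b, s}, c {b, u}]"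
    define g where "g x = (if x = (0,0) then b else if x = (0,1) then p else
      if x = (0,2) then q else if x = (0,3) then r else if x = (1,1) then s else u)"
      for x :: "nat \<times> nat"
    have g: "g (0,0) = b" "g (0,1) = p" "g (0,Suc 0) = p" "g (0,2) = q" "g (0,3) = r"
      "g (1,1) = s" "g (Suc 0,Suc 0) = s" "g (2,1) = u" "g (2,Suc 0) = u"
      by (simp_all add: g_def)
    have "inj_on g (verts (spider_graph 3 1 1))"
      unfolding verts_spider_311 using d by (simp add: g)
    moreover have "g ` verts (spider_graph 3 1 1) \<subseteq> verts K"
      unfolding verts_spider_311 using V by (simp add: g)
    moreover have "inj_on (\<lambda>e. c (g ` e)) (edges (spider_graph 3 1 1))"
      unfolding edges_spider_311 using col by (simp add: g inj_on_def doubleton_eq_iff) metis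
    ultimately show False
      using L rainbow_free_complete_iff[OF K simple_graph_spider_graph] by blast
  qed
next
  assume R: ?R
  show ?L
    unfolding rainbow_free_complete_iff[OF K simple_graph_spider_graph]
  proof (intro notI, elim exE conjE)
    fix g assume i: "inj_on g (verts (spider_graph 3 1 1))"
      and V: "g ` verts (spider_graph 3 1 1) \<subseteq> verts K"
      and col: "inj_on (\<lambda>e. c (g ` e)) (edges (spider_graph 3 1 1))"
    have d: "distinct [g (0,0), g (0,1), g (0,2), g (0,3), g (1,1), g (2,1)]"
      using i unfolding verts_spider_311 inj_on_def by simp
    have V': "{g (0,0), g (0,1), g (0,2), g (0,3), g (1,1), g (2,1)} \<subseteq> verts K"
      using V unfolding verts_spider_311 by simp
    have "distinct [c {g (0,0), g (0,1)}, c {g (0,1), g (0,2)}, c {g (0,2), g (0,3)},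
        c {g (0,0), g (1,1)}, c {g (0,0), g (2,1)}]"
      using col unfolding edges_spider_311 inj_on_def by (simp add: doubleton_eq_iff)
    then show False using R[rule_format, OF d V'] by simp
  qed
qed

section \<open>A coloring with a rainbow 4-cycle and no rainbow spider\<close>

text \<open>The cyclic order 0-1-3-2 keeps the four edge sums distinct; 0-1-2-3 would give 3 twice.
  The matching is infinite, so one coloring serves hosts of every size.\<close>

definition C4_matching :: "nat set set" where
  "C4_matching = {{0,1}, {0,2}, {1,3}, {2,3}} \<union> {{2*i+4, 2*i+5} | i. True}"

text \<open>The sums \<open>\<Sum>e\<close> are nonzero and pairwise distinct on \<^const>\<open>C4_matching\<close>:
  1, 2, 4, 5 on the 4-cycle 0-1-3-2 and \<open>4 * i + 9\<close> on the matching. A rainbow subgraph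
  thus has at most one edge outside \<^const>\<open>C4_matching\<close>.\<close>

definition C4_coloring :: "nat coloring" where
  "C4_coloring e = (if e \<in> C4_matching then \<Sum>e else 0)"

lemma C4_matching_cases:
  "{u, v} \<in> C4_matching \<longleftrightarrow>
    (u, v) \<in> {(0,1),(1,0),(0,2),(2,0),(1,3),(3,1),(2,3),(3,2)} \<or>
    (\<exists>i. u = 2*i+4 \<and> v = 2*i+5 \<or> u = 2*i+5 \<and> v = 2*i+4)"
  unfolding C4_matching_def by (auto simp: doubleton_eq_iff)

text \<open>Endpoints of matching edges have degree 1, so a vertex with two neighbours lies on the
  4-cycle.\<close>

lemma C4_matching_less_4:
  assumes "{u, v} \<in> C4_matching" "{u, w} \<in> C4_matching" "v \<noteq> w"
  shows "u < 4 \<and> v < 4 \<and> w < 4"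
  using assms unfolding C4_matching_cases by auto presburger+

lemma C4_matching_degree:
  assumes "{u, v} \<in> C4_matching" "{u, w} \<in> C4_matching" "{u, x} \<in> C4_matching"
  shows "v = w \<or> v = x \<or> w = x"
  using assms C4_matching_less_4[OF assms(1,2)] C4_matching_less_4[OF assms(1,3)]
  unfolding C4_matching_cases by auto

lemma not_distinct_less_4:
  assumes "distinct [x1, x2, x3, x4, x5 :: nat]" "\<forall>x\<in>{x1, x2, x3, x4, x5}. x < 4"
  shows False
proof -
  have "card (set [x1, x2, x3, x4, x5]) \<le> card {..<4::nat}"
    using assms(2) by (intro card_mono) auto
  then show False using distinct_card[OF assms(1)] by simp
qed

lemma C4_coloring_rainbow_free:
  assumes K: "complete_graph K"
  shows "rainbow_free (spider_graph 3 1 1) K C4_coloring"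
  unfolding rainbow_free_spider_311_iff[OF K]
proof (intro allI impI notI)
  fix b p q r s u
  assume d: "distinct [b, p, q, r, s, u]"
    and col: "distinct [C4_coloring {b, p}, C4_coloring {p, q}, C4_coloring {q, r},
      C4_coloring {b, s}, C4_coloring {b, u}]"
  let ?F = C4_matching
  have one: "d \<in> ?F \<or> e \<in> ?F" if "C4_coloring d \<noteq> C4_coloring e" for d e
    using that by (auto simp: C4_coloring_def split: if_splits)
  have qp: "{p, q} = {q, p}" by auto
  \<comment> \<open>The branch vertex has degree 3, so the single edge outside
    \<open>C4_matching\<close> is one of its edges. Then \<open>b\<close> keeps two neighbours and
    \<open>q\<close> has both \<open>p\<close> and \<open>r\<close>, which puts too many vertices
    below 4.\<close>
  have "{b, p} \<notin> ?F \<or> {b, s} \<notin> ?F \<or> {b, u} \<notin> ?F"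
    using C4_matching_degree[of b p s u] d by auto
  then consider "{b, p} \<notin> ?F" | "{b, s} \<notin> ?F" | "{b, u} \<notin> ?F" by blast
  then show False
  proof cases
    case 1
    then have F: "{p, q} \<in> ?F" "{q, r} \<in> ?F" "{b, s} \<in> ?F" "{b, u} \<in> ?F"
      using col one by auto
    have "b < 4 \<and> s < 4 \<and> u < 4"
      using F d C4_matching_less_4[of b s u] by auto
    moreover have "q < 4 \<and> p < 4 \<and> r < 4"
      using F d C4_matching_less_4[of q p r] unfolding qp by auto
    ultimately show False using d not_distinct_less_4[of b s u p q] by auto
  next
    case 2
    then have F: "{p, q} \<in> ?F" "{q, r} \<in> ?F" "{b, p} \<in> ?F" "{b, u} \<in> ?F"
      using col one by auto
    have "b < 4 \<and> p < 4 \<and> u < 4"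
      using F d C4_matching_less_4[of b p u] by auto
    moreover have "q < 4 \<and> p < 4 \<and> r < 4"
      using F d C4_matching_less_4[of q p r] unfolding qp by auto
    ultimately show False using d not_distinct_less_4[of b p u q r] by auto
  next
    case 3
    then have F: "{p, q} \<in> ?F" "{q, r} \<in> ?F" "{b, p} \<in> ?F" "{b, s} \<in> ?F"
      using col one by auto
    have "b < 4 \<and> p < 4 \<and> s < 4"
      using F d C4_matching_less_4[of b p s] by auto
    moreover have "q < 4 \<and> p < 4 \<and> r < 4"
      using F d C4_matching_less_4[of q p r] unfolding qp by auto
    ultimately show False using d not_distinct_less_4[of b p s q r] by auto
  qed
qed

lemma edges_cycle_graph: "edges (cycle_graph k) = (\<lambda>i. {i, (i + 1) mod k}) ` {..<k}"
  by (auto simp: cycle_graph_def)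

lemma spider_311_not_le_C4: "\<not> rainbow_le (spider_graph 3 1 1) (cycle_graph 4)"
  unfolding rainbow_le_def
proof (intro notI, elim exE conjE)
  fix t :: nat
  assume *: "\<forall>(K :: nat graph) c. complete_graph K \<longrightarrow> t \<le> card (c ` edges K) \<longrightarrow>
    rainbow_free (spider_graph 3 1 1) K c \<longrightarrow> rainbow_free (cycle_graph 4) K c"
  \<comment> \<open>The matching edges with \<open>i < t\<close> occupy the vertices from 4 to
    \<open>2*t+3\<close> and provide \<open>t\<close> colors.\<close>
  define K where "K = ({..<2*t+4}, all_pairs {..<2*t+4})"
  have K: "complete_graph K"
    by (auto simp: K_def complete_graph_def simple_graph_def)
  have "(\<lambda>i. 4*i+9) ` {..<t} \<subseteq> C4_coloring ` edges K"
  proof (rule image_subsetI)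
    fix i assume "i \<in> {..<t}"
    then have "{2*i+4, 2*i+5} \<in> edges K"
      by (auto simp: K_def all_pairs_def)
    moreover have "{2*i+4, 2*i+5} \<in> C4_matching"
      unfolding C4_matching_def by blast
    then have "C4_coloring {2*i+4, 2*i+5} = 4*i+9"
      by (simp add: C4_coloring_def)
    ultimately show "4*i+9 \<in> C4_coloring ` edges K"
      by (metis imageI)
  qed
  moreover have "finite (edges K)"
    unfolding K_def all_pairs_def by simp
  ultimately have "card ((\<lambda>i. 4*i+9) ` {..<t}) \<le> card (C4_coloring ` edges K)"
    by (intro card_mono) auto
  moreover have "card ((\<lambda>i. 4*i+9) ` {..<t}) = t"
    by (simp add: card_image inj_on_def)
  ultimately have "rainbow_free (cycle_graph 4) K C4_coloring"
    using * K C4_coloring_rainbow_free by metis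
  moreover have "\<not> rainbow_free (cycle_graph 4) K C4_coloring"
  proof -
    \<comment> \<open>The list follows the 4-cycle in its cyclic order.\<close>
    define g :: "nat \<Rightarrow> nat" where "g i = [0,1,3,2] ! i" for i
    have g: "g 0 = 0" "g 1 = 1" "g (Suc 0) = 1" "g 2 = 3" "g 3 = 2"
      by (simp_all add: g_def numeral_2_eq_2 numeral_3_eq_3)
    have l4: "{..<4} = {0, 1, 2, 3 :: nat}" by auto
    have V: "verts (cycle_graph 4) = {0, 1, 2, 3}"
      by (simp add: cycle_graph_def l4)
    have E: "edges (cycle_graph 4) = {{0,1}, {1,2}, {2,3}, {3,0}}"
      by (simp add: edges_cycle_graph l4) (simp add: numeral_2_eq_2)
    have c: "C4_coloring {0, 1} = 1" "C4_coloring {1, 3} = 4" "C4_coloring {3, 2} = 5"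
      "C4_coloring {2, 0} = 2"
      by (simp_all add: C4_coloring_def C4_matching_cases)
    have "inj_on g (verts (cycle_graph 4))" "g ` verts (cycle_graph 4) \<subseteq> verts K"
      unfolding V by (simp_all add: g K_def)
    moreover have "inj_on (\<lambda>e. C4_coloring (g ` e)) (edges (cycle_graph 4))"
      unfolding E using c by (simp add: g inj_on_def)
    ultimately show ?thesis
      using rainbow_free_complete_iff[OF K simple_graph_cycle_graph[of 4]] by auto
  qed
  ultimately show False by blast
qed

section \<open>A rainbow cycle in a coloring without rainbow spiders\<close>

text \<open>Indexing the cycle periodically by the integers turns reversal of the cycle into
  \<open>i \<mapsto> - i\<close>, so each lemma comes with its mirror image.\<close>

locale spider_free_cycle =
  fixes k :: int and K :: "'a graph" and c :: "'a coloring" and w :: "int \<Rightarrow> 'a"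
  assumes k5: "k \<ge> 5"
    and complete: "complete_graph K"
    and free: "rainbow_free (spider_graph 3 1 1) K c"
    and w_in: "w i \<in> verts K"
    and w_eq_iff: "w i = w j \<longleftrightarrow> k dvd i - j"
    and c_eq_iff: "c {w i, w (i + 1)} = c {w j, w (j + 1)} \<longleftrightarrow> k dvd i - j"
begin

definition col :: "int \<Rightarrow> nat" where
  "col i = c {w i, w (i + 1)}"

lemma col_eq_iff: "col i = col j \<longleftrightarrow> k dvd i - j"
  by (simp add: col_def c_eq_iff)

lemma not_dvd: "0 < \<bar>n\<bar> \<Longrightarrow> \<bar>n\<bar> < k \<Longrightarrow> \<not> k dvd n"
  using dvd_imp_le_int[of n k] by auto

lemma no_spider:
  assumes "distinct [b, p, q, r, s, u]" "{b, p, q, r, s, u} \<subseteq> verts K"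
    "distinct [c {b, p}, c {p, q}, c {q, r}, c {b, s}, c {b, u}]"
  shows False
  using free assms unfolding rainbow_free_spider_311_iff[OF complete] by blast

lemma reflected: "spider_free_cycle k K c (\<lambda>i. w (- i))"
proof
  show "w (- i) = w (- j) \<longleftrightarrow> k dvd i - j" for i j
    using w_eq_iff[of "- i" "- j"] by (simp add: dvd_diff_commute)
  show "c {w (- i), w (- (i + 1))} = c {w (- j), w (- (j + 1))} \<longleftrightarrow> k dvd i - j" for i j
    using c_eq_iff[of "- i - 1" "- j - 1"] by (simp add: dvd_diff_commute insert_commute)
qed (use k5 complete free w_in in auto)

text \<open>The shift by one arises because edge \<open>i\<close> of the reversed cycle joins
  \<open>w (- i)\<close> to \<open>w (- i - 1)\<close>.\<close>

lemma col_reflected: "spider_free_cycle.col c (\<lambda>i. w (- i)) i = col (- i - 1)"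
  by (simp add: spider_free_cycle.col_def[OF reflected] col_def insert_commute)

section \<open>Edges leaving the cycle\<close>

text \<open>Take branch vertex \<open>w i\<close>, long leg \<open>w (i + 1)\<close>,
  \<open>w (i + 2)\<close>, \<open>w (i + 3)\<close> and short legs \<open>w (i - 1)\<close> and
  \<open>x\<close>. The four cycle edges differ in color, so the edge to \<open>x\<close> repeats
  one of them.\<close>

lemma crossing_forward:
  assumes x: "x \<in> verts K" "x \<notin> range w"
  shows "c {w i, x} \<in> {col (i - 1), col i, col (i + 1), col (i + 2)}"
proof (rule ccontr)
  assume n: "\<not> ?thesis"
  have xw: "x \<noteq> w j" "w j \<noteq> x" for j using x by auto
  have e: "c {w i, w (i + 1)} = col i" "c {w (i + 1), w (i + 2)} = col (i + 1)"
    "c {w (i + 2), w (i + 3)} = col (i + 2)" "c {w i, w (i - 1)} = col (i - 1)"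
    by (simp_all add: col_def insert_commute add.assoc)
  show False
  proof (rule no_spider)
    show "distinct [w i, w (i + 1), w (i + 2), w (i + 3), w (i - 1), x]"
      using k5 by (simp add: xw w_eq_iff not_dvd)
    show "{w i, w (i + 1), w (i + 2), w (i + 3), w (i - 1), x} \<subseteq> verts K"
      using x w_in by simp
    show "distinct [c {w i, w (i + 1)}, c {w (i + 1), w (i + 2)}, c {w (i + 2), w (i + 3)},
        c {w i, w (i - 1)}, c {w i, x}]"
      using k5 n unfolding e by (simp add: col_eq_iff not_dvd)
  qed
qed

text \<open>Intersects the colors of \<open>crossing_forward\<close> with their mirror images
  \<open>col i\<close> down to \<open>col (i - 3)\<close>. Beyond the two common colors, only
  \<open>col (i + 2)\<close> and \<open>col (i - 3)\<close> can coincide, and only for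
  \<open>k = 5\<close>.\<close>

lemma crossing:
  assumes x: "x \<in> verts K" "x \<notin> range w"
  shows "c {x, w i} \<in> {col (i - 1), col i} \<or> k = 5 \<and> c {x, w i} = col (i + 2)"
proof -
  interpret r: spider_free_cycle k K c "\<lambda>i. w (- i)" by (rule reflected)
  have "c {w i, x} \<in> {col (i - 1), col i, col (i + 1), col (i + 2)}"
    by (rule crossing_forward[OF x])
  moreover have "c {w i, x} \<in> {col i, col (i - 1), col (i - 2), col (i - 3)}"
    using r.crossing_forward[of x "- i"] x by (auto simp: col_reflected)
  moreover have "col (i + 1) \<notin> {col (i - 2), col (i - 3)}" "col (i + 2) \<noteq> col (i - 2)"
    using k5 by (auto simp: col_eq_iff not_dvd)
  moreover have "k = 5" if "col (i + 2) = col (i - 3)"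
    using that k5 not_dvd[of 5] by (force simp: col_eq_iff)
  ultimately show ?thesis by (auto simp: insert_commute)
qed

section \<open>Edges disjoint from the cycle\<close>

text \<open>The spider behind this lemma has branch vertex \<open>x\<close>, long leg
  \<open>w i, w (i + 1), w (i + 2)\<close> and short legs \<open>y\<close> and \<open>w j\<close>.\<close>

lemma branch_outside:
  assumes x: "x \<in> verts K" "x \<notin> range w" and y: "y \<in> verts K" "y \<notin> range w" "x \<noteq> y"
    and new: "c {x, y} \<notin> range col"
    and j: "\<not> k dvd j - i" "\<not> k dvd j - (i + 1)" "\<not> k dvd j - (i + 2)"
    and i: "c {x, w i} \<notin> {col i, col (i + 1)}"
    and cj: "c {x, w j} \<notin> {c {x, w i}, col i, col (i + 1)}"
  shows False
proof -
  have xw: "x \<noteq> w j" "w j \<noteq> x" "y \<noteq> w j" "w j \<noteq> y" for j using x y by auto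
  have e: "c {w i, w (i + 1)} = col i" "c {w (i + 1), w (i + 2)} = col (i + 1)"
    by (simp_all add: col_def add.assoc)
  have cross: "c {x, w i} \<in> range col" for i
    using crossing[OF x, of i] by auto
  have new': "c {x, y} \<noteq> c {x, w i}" "c {x, y} \<noteq> col i" "c {x, w i} \<noteq> c {x, y}" "col i \<noteq> c {x, y}" for i
    by (metis new cross rangeI)+
  have wj: "w i \<noteq> w j" "w (i + 1) \<noteq> w j" "w (i + 2) \<noteq> w j"
    using j by (metis w_eq_iff)+
  show False
  proof (rule no_spider)
    show "distinct [x, w i, w (i + 1), w (i + 2), y, w j]"
      using k5 y(3) wj by (simp add: xw w_eq_iff not_dvd)
    show "{x, w i, w (i + 1), w (i + 2), y, w j} \<subseteq> verts K"
      using x y w_in by simp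
    show "distinct [c {x, w i}, c {w i, w (i + 1)}, c {w (i + 1), w (i + 2)},
        c {x, y}, c {x, w j}]"
      using k5 i cj unfolding e by (simp add: new' col_eq_iff not_dvd)
  qed
qed

text \<open>The second short leg ends at \<open>w (i + 4)\<close>: for \<open>k \<ge> 6\<close> both
  colors that \<open>crossing\<close> leaves there avoid \<open>col (i - 1)\<close>,
  \<open>col i\<close> and \<open>col (i + 1)\<close> on the long leg.\<close>

lemma no_new_color_ge_6_forward:
  assumes x: "x \<in> verts K" "x \<notin> range w" and y: "y \<in> verts K" "y \<notin> range w" "x \<noteq> y"
    and new: "c {x, y} \<notin> range col" and k: "k \<noteq> 5" and i: "c {x, w i} = col (i - 1)"
  shows False
proof (rule branch_outside[OF x y new, of "i + 4" i])
  have c4: "c {x, w (i + 4)} \<in> {col (i + 3), col (i + 4)}"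
    using crossing[OF x, of "i + 4"] k by (auto simp: algebra_simps)
  show "c {x, w (i + 4)} \<notin> {c {x, w i}, col i, col (i + 1)}"
    using c4 k k5 by (auto simp: i col_eq_iff not_dvd)
qed (use k5 k in \<open>auto simp: i col_eq_iff not_dvd\<close>)

text \<open>At \<open>w 0\<close> only \<open>col (- 1)\<close> and \<open>col 0\<close> remain, and
  reflection swaps them.\<close>

lemma no_new_color_ge_6:
  assumes x: "x \<in> verts K" "x \<notin> range w" and y: "y \<in> verts K" "y \<notin> range w" "x \<noteq> y"
    and new: "c {x, y} \<notin> range col" and k: "k \<noteq> 5"
  shows False
proof -
  interpret r: spider_free_cycle k K c "\<lambda>i. w (- i)" by (rule reflected)
  have "range r.col \<subseteq> range col" "range (\<lambda>i. w (- i)) \<subseteq> range w"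
    by (auto simp: col_reflected)
  moreover have "c {x, w 0} = col (- 1) \<or> c {x, w 0} = col 0"
    using crossing[OF x, of 0] k by auto
  ultimately show False
    using no_new_color_ge_6_forward[OF x y new k, of 0]
      r.no_new_color_ge_6_forward[of x y 0] x y new k
    by (auto simp: col_reflected)
qed

text \<open>For \<open>k = 5\<close> the edge of color \<open>col (i + 2)\<close> is the one opposite to \<open>w i\<close>.
  This additional color survives all spiders centered at \<open>x\<close>; it is excluded only
  by the long leg \<open>x, y, w 0, w 1\<close>.\<close>

lemma opposite_step:
  assumes x: "x \<in> verts K" "x \<notin> range w" and y: "y \<in> verts K" "y \<notin> range w" "x \<noteq> y"
    and new: "c {x, y} \<notin> range col" and k: "k = 5" and i: "c {x, w i} = col (i + 2)"
  shows "c {x, w (i + 1)} = col (i + 3)"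
proof (rule ccontr)
  assume n: "\<not> ?thesis"
  interpret r: spider_free_cycle k K c "\<lambda>i. w (- i)" by (rule reflected)
  have s: "range r.col \<subseteq> range col" "range (\<lambda>i. w (- i)) \<subseteq> range w"
    by (auto simp: col_reflected)
  have c1: "c {x, w (i + 1)} \<in> {col i, col (i + 1)}"
    using crossing[OF x, of "i + 1"] n by (auto simp: add.assoc)
  show False
  \<comment> \<open>In original indices the long leg is \<open>w i\<close>,
    \<open>w (i - 1)\<close>, \<open>w (i - 2)\<close>, with color indices i+2, i+4, i+3 modulo 5;
    the short leg \<open>w (i + 1)\<close> has i or i+1.\<close>
  proof (rule r.branch_outside[of x y "- i - 1" "- i"])
    show "c {x, w (- (- i - 1))} \<notin> {c {x, w (- (- i))}, r.col (- i), r.col (- i + 1)}"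
      using c1 k by (auto simp: i col_reflected col_eq_iff add.commute)
  qed (use x y new s k in \<open>auto simp: i col_reflected col_eq_iff\<close>)
qed

text \<open>Modulo 5 the long leg through \<open>w i\<close> has color indices i+4, i, i+1. At
  \<open>w (i + 3)\<close> the indices i+2 and i+3 would complete a rainbow spider, leaving the
  opposite color \<open>col (i + 5)\<close>, which is \<open>col i\<close>.\<close>

lemma opposite_start:
  assumes x: "x \<in> verts K" "x \<notin> range w" and y: "y \<in> verts K" "y \<notin> range w" "x \<noteq> y"
    and new: "c {x, y} \<notin> range col" and k: "k = 5" and i: "c {x, w i} = col (i - 1)"
  shows "c {x, w (i + 3)} = col i"
proof (rule ccontr)
  assume n: "\<not> ?thesis"
  have "col (i + 5) = col i" by (simp add: col_eq_iff k)
  then have c3: "c {x, w (i + 3)} \<in> {col (i + 2), col (i + 3)}"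
    using crossing[OF x, of "i + 3"] n by (auto simp: algebra_simps)
  show False
  proof (rule branch_outside[OF x y new, of "i + 3" i])
    show "c {x, w (i + 3)} \<notin> {c {x, w i}, col i, col (i + 1)}"
      using c3 k by (auto simp: i col_eq_iff)
  qed (use k in \<open>auto simp: i col_eq_iff\<close>)
qed

text \<open>The three possible colors at \<open>w 0\<close> each yield one index with the opposite
  color, through \<open>opposite_start\<close>, its mirror image, or directly;
  \<open>opposite_step\<close> carries it around the cycle.\<close>

lemma opposite_all:
  assumes x: "x \<in> verts K" "x \<notin> range w" and y: "y \<in> verts K" "y \<notin> range w" "x \<noteq> y"
    and new: "c {x, y} \<notin> range col" and k: "k = 5"
  shows "c {x, w i} = col (i + 2)"
proof -
  interpret r: spider_free_cycle k K c "\<lambda>i. w (- i)" by (rule reflected)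
  have s: "range r.col \<subseteq> range col" "range (\<lambda>i. w (- i)) \<subseteq> range w"
    by (auto simp: col_reflected)
  have per: "col 5 = col 0"
    by (simp add: col_eq_iff k)
  consider "c {x, w 0} = col (- 1)" | "c {x, w 0} = col 0" | "c {x, w 0} = col 2"
    using crossing[OF x, of 0] by auto
  then have "\<exists>j. c {x, w j} = col (j + 2)"
  proof cases
    case 1
    then have "c {x, w 3} = col (3 + 2)"
      using opposite_start[OF x y new k, of 0] per by simp
    then show ?thesis by blast
  next
    case 2
    then have "c {x, w (- 3)} = col (- 3 + 2)"
      using r.opposite_start[of x y 0] x y new s k by (auto simp: col_reflected)
    then show ?thesis by blast
  next
    case 3
    then show ?thesis by (metis add_0)
  qed
  then obtain j where j: "c {x, w j} = col (j + 2)" ..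
  have "c {x, w (j + int n)} = col (j + int n + 2)" for n
  proof (induction n)
    case (Suc n)
    then show ?case
      using opposite_step[OF x y new k, of "j + int n"] by (simp add: algebra_simps)
  qed (simp add: j)
  \<comment> \<open>Propagation runs only forward, so the nonnegative residue is taken as the number
    of steps.\<close>
  from this[of "nat ((i - j) mod 5)"]
  have *: "c {x, w (j + (i - j) mod 5)} = col (j + (i - j) mod 5 + 2)" by simp
  have "5 dvd (j + (i - j) mod 5) - i" "5 dvd (j + (i - j) mod 5 + 2) - (i + 2)"
    by presburger+
  then show ?thesis
    using * w_eq_iff col_eq_iff k by metis
qed

text \<open>With opposite colors at both \<open>x\<close> and \<open>y\<close>, the spider with
  short legs \<open>w 2\<close> and \<open>w 4\<close> has the new color together with
  \<open>col 2\<close>, \<open>col 0\<close>, \<open>col 4\<close> and \<open>col 6\<close>, the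
  last being \<open>col 1\<close>.\<close>

lemma no_new_color_5:
  assumes x: "x \<in> verts K" "x \<notin> range w" and y: "y \<in> verts K" "y \<notin> range w" "x \<noteq> y"
    and new: "c {x, y} \<notin> range col" and k: "k = 5"
  shows False
proof -
  have cx: "c {x, w i} = col (i + 2)" for i
    by (rule opposite_all[OF x y new k])
  have cy: "c {y, w i} = col (i + 2)" for i
    using opposite_all[OF y(1,2) x y(3)[symmetric] _ k] new by (simp add: insert_commute)
  have xw: "x \<noteq> w j" "w j \<noteq> x" "y \<noteq> w j" "w j \<noteq> y" for j using x y by auto
  have new': "c {x, y} \<noteq> col i" "col i \<noteq> c {x, y}" for i
    by (metis new rangeI)+
  have e: "c {w 0, w 1} = col 0" by (simp add: col_def)
  show False
  proof (rule no_spider)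
    show "distinct [x, y, w 0, w 1, w 2, w 4]"
      using y(3) by (simp add: xw w_eq_iff k)
    show "{x, y, w 0, w 1, w 2, w 4} \<subseteq> verts K"
      using x y w_in by simp
    show "distinct [c {x, y}, c {y, w 0}, c {w 0, w 1}, c {x, w 2}, c {x, w 4}]"
      unfolding cx cy e by (simp add: new' col_eq_iff k)
  qed
qed

text \<open>By \<open>crossing\<close>, a color missing from the cycle can only sit inside it or
  disjoint from it, and the latter is excluded. Allowing all subsets in \<open>Pow\<close> is crude
  but suffices for counting colors.\<close>

lemma color_meets_cycle:
  assumes e: "e \<in> edges K"
  shows "c e \<in> c ` Pow (range w)"
proof (rule ccontr)
  assume n: "\<not> ?thesis"
  obtain x y where xy: "e = {x, y}" "x \<noteq> y" "x \<in> verts K" "y \<in> verts K"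
    using e complete by (auto simp: complete_graph_def mem_all_pairs_iff)
  have col: "col i \<in> c ` Pow (range w)" for i
    by (auto simp: col_def)
  then have new: "c e \<notin> range col" using n by auto
  have out: "u \<notin> range w" if u: "e = {u, v}" "v \<in> verts K" for u v
  proof
    assume "u \<in> range w"
    then obtain i where i: "u = w i" by auto
    have "v \<notin> range w" using n i u by auto
    then have "c {v, w i} \<in> range col"
      using crossing[OF u(2), of i] by auto
    then show False using new u i by (simp add: insert_commute)
  qed
  have "x \<notin> range w" "y \<notin> range w"
    using out[of x y] out[of y x] xy by (auto simp: insert_commute)
  then show False
    using no_new_color_5[of x y] no_new_color_ge_6[of x y] xy new by blast
qed

end

section \<open>From rainbow cycles to a bound on the number of colors\<close>

lemma spider_free_cycle_of_rainbow_cycle: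
  fixes g :: "nat \<Rightarrow> 'a"
  assumes k: "k \<ge> 5" and K: "complete_graph K"
    and free: "rainbow_free (spider_graph 3 1 1) K c"
    and g: "inj_on g {..<k}" "g ` {..<k} \<subseteq> verts K"
    and r: "inj_on (\<lambda>e. c (g ` e)) (edges (cycle_graph k))"
  shows "spider_free_cycle (int k) K c (\<lambda>i. g (nat (i mod int k)))"
proof
  define n where "n i = nat (i mod int k)" for i
  have nk: "n i < k" for i
    using k by (simp add: n_def nat_less_iff)
  have n_eq: "n i = n j \<longleftrightarrow> int k dvd i - j" for i j
    using k by (simp add: n_def eq_nat_nat_iff mod_eq_dvd_iff)
  have n_Suc: "n (i + 1) = (n i + 1) mod k" for i
  proof -
    have "int (n (i + 1)) = (i + 1) mod int k"
      using k by (simp add: n_def)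
    also have "\<dots> = (i mod int k + 1) mod int k"
      by (rule mod_add_left_eq[symmetric])
    also have "\<dots> = int ((n i + 1) mod k)"
      using k by (simp add: n_def zmod_int add.commute)
    finally show ?thesis by simp
  qed
  have edge: "{n i, n (i + 1)} \<in> edges (cycle_graph k)" for i
    unfolding edges_cycle_graph n_Suc using nk[of i] by (intro image_eqI[of _ _ "n i"]) auto
  show "g (nat (i mod int k)) \<in> verts K" for i
    using g nk[of i] by (auto simp: n_def)
  show "g (nat (i mod int k)) = g (nat (j mod int k)) \<longleftrightarrow> int k dvd i - j" for i j
    using inj_on_eq_iff[OF g(1), of "n i" "n j"] nk n_eq by (simp add: n_def)
  have "{n i, n (i + 1)} = {n j, n (j + 1)} \<longleftrightarrow> int k dvd i - j" for i j
  proof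
    assume *: "{n i, n (i + 1)} = {n j, n (j + 1)}"
    \<comment> \<open>If two edges agreed with their endpoints swapped, \<open>k\<close> would
      divide 2.\<close>
    have False if "n i = n (j + 1)" "n (i + 1) = n j"
    proof -
      have "int k dvd (i + 1 - j) - (i - (j + 1))"
        using that n_eq dvd_diff[of "int k" "i + 1 - j" "i - (j + 1)"] by simp
      then show False
        using k zdvd_imp_le[of "int k" 2] by simp
    qed
    then show "int k dvd i - j"
      using * n_eq by (auto simp: doubleton_eq_iff)
  next
    assume "int k dvd i - j"
    then have "n i = n j" by (simp add: n_eq)
    then show "{n i, n (i + 1)} = {n j, n (j + 1)}" by (simp add: n_Suc)
  qed
  moreover have "c (g ` {n i, n (i + 1)}) = c (g ` {n j, n (j + 1)}) \<longleftrightarrow>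
      {n i, n (i + 1)} = {n j, n (j + 1)}" for i j
    using inj_on_eq_iff[OF r edge edge] .
  ultimately show "c {g (nat (i mod int k)), g (nat ((i + 1) mod int k))} =
      c {g (nat (j mod int k)), g (nat ((j + 1) mod int k))} \<longleftrightarrow> int k dvd i - j" for i j
    by (simp add: n_def)
qed (use k K free in auto)

lemma spider_311_le_cycle:
  assumes k: "k \<ge> 5"
  shows "rainbow_le (spider_graph 3 1 1) (cycle_graph k)"
  unfolding rainbow_le_def
\<comment> \<open>The threshold is one more than the number of vertex subsets of the cycle.\<close>
proof (intro exI[of _ "2 ^ k + 1"] conjI allI impI)
  fix K :: "nat graph" and c
  assume K: "complete_graph K" and t: "2 ^ k + 1 \<le> card (c ` edges K)"
    and free: "rainbow_free (spider_graph 3 1 1) K c"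
  show "rainbow_free (cycle_graph k) K c"
  proof (rule ccontr)
    assume "\<not> rainbow_free (cycle_graph k) K c"
    then obtain g where g: "inj_on g {..<k}" "g ` {..<k} \<subseteq> verts K"
      "inj_on (\<lambda>e. c (g ` e)) (edges (cycle_graph k))"
      using rainbow_free_complete_iff[OF K simple_graph_cycle_graph, of k c] k
      by (auto simp: cycle_graph_def)
    interpret spider_free_cycle "int k" K c "\<lambda>i. g (nat (i mod int k))"
      by (rule spider_free_cycle_of_rainbow_cycle[OF k K free g])
    have range: "range (\<lambda>i. g (nat (i mod int k))) \<subseteq> g ` {..<k}"
      using k by (auto simp: nat_less_iff)
    have "c ` edges K \<subseteq> c ` Pow (g ` {..<k})"
      by (rule image_subsetI) (rule subsetD[OF image_mono[OF Pow_mono[OF range]] color_meets_cycle])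
    then have "card (c ` edges K) \<le> card (c ` Pow (g ` {..<k}))"
      by (intro card_mono) auto
    also have "\<dots> \<le> card (Pow (g ` {..<k}))"
      by (intro card_image_le) auto
    also have "\<dots> = 2 ^ k"
      using g(1) by (simp add: card_Pow card_image)
    finally show False using t by simp
  qed
qed simp

theorem theorem13:
  "\<not> rainbow_le (spider_graph 3 1 1) (cycle_graph 4) \<and>
   (\<forall>k\<ge>5. rainbow_le (spider_graph 3 1 1) (cycle_graph k))"
  using spider_311_not_le_C4 spider_311_le_cycle by blast

end
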